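(* The Polish group $G=\mathbb Z^\omega$ contains a subgroup $H$ such that: (i) $H$ is meager in $G$ and $\sigma$-Polish; (ii) $H\subset\{0\}\cup\{z\in\mathbb Z^\omega: z^{-1}(0)\text{ is finite}\}$, where $z^{-1}(0)=\{n\in\omega:z(n)=0\}$; (iii) $H$ cannot be covered by countably many closed Haar-meager sets in $G$; (iv) $H$ is generated by a $G_\delta$-subset $P\subset\mathbb Z^\omega$ such that for any non-empty relatively open set $U\subset P$ its closure $\overline U$ in $G$ is prethick in $G$.
   Context: $\mathbb Z^\omega$ is the countable power of the discrete group $\mathbb Z$, with coordinatewise addition and the product topology. A topological space $X$ is $\sigma$-Polish if $X=\bigcup_{n\in\omega}X_n$ for some closed Polish subspaces $X_n$ of $X$. A subset $A$ of a topological group $G$ is Haar-meager if there is a continuous map $f:K\to G$ defined on a non-empty compact metrizable space $K$ such that for all $x,y\in G$ the set $f^{-1}(xAy)$ is meager in $K$. A subset $T\subset G$ is prethick if for every compact set $K\subset G$ there is a finite set $F\subset G$ with $K\subset FTF=\{atb:a,b\in F,\ t\in T\}$. *)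

theory Defs
  imports "HOL-Analysis.Analysis" "HOL-Algebra.Product_Groups"
begin

section \<open>Category and Polish spaces\<close>

definition nowhere_dense_in :: "'a topology \<Rightarrow> 'a set \<Rightarrow> bool" where
  "nowhere_dense_in X S \<longleftrightarrow> S \<subseteq> topspace X \<and> X interior_of (X closure_of S) = {}"

definition meager_in :: "'a topology \<Rightarrow> 'a set \<Rightarrow> bool" where
  "meager_in X S \<longleftrightarrow> (\<exists>N :: nat \<Rightarrow> 'a set. (\<forall>n. nowhere_dense_in X (N n)) \<and> S = (\<Union>n. N n))"

definition Polish_space :: "'a topology \<Rightarrow> bool" where
  "Polish_space X \<longleftrightarrow> separable_space X \<and> completely_metrizable_space X"

definition sigma_Polish_space :: "'a topology \<Rightarrow> bool" where
  "sigma_Polish_space X \<longleftrightarrow>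
     (\<exists>F :: nat \<Rightarrow> 'a set.
        (\<forall>n. closedin X (F n) \<and> Polish_space (subtopology X (F n))) \<and>
        topspace X = (\<Union>n. F n))"


section \<open>Topological groups\<close>

text \<open>A topological group is a group \<open>G\<close> together with a topology \<open>X\<close> on its carrier.\<close>

definition topological_group :: "('a, 'm) monoid_scheme \<Rightarrow> 'a topology \<Rightarrow> bool" where
  "topological_group G X \<longleftrightarrow>
     group G \<and> topspace X = carrier G \<and>
     continuous_map (prod_topology X X) X (\<lambda>(x, y). x \<otimes>\<^bsub>G\<^esub> y) \<and>
     continuous_map X X (\<lambda>x. inv\<^bsub>G\<^esub> x)"

definition Polish_group :: "('a, 'm) monoid_scheme \<Rightarrow> 'a topology \<Rightarrow> bool" where
  "Polish_group G X \<longleftrightarrow> topological_group G X \<and> Polish_space X"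

text \<open>
  HOL cannot quantify existentially over the type of points of the compact space \<open>K\<close>. This is
  harmless: a compact metrizable space embeds into the Hilbert cube, so up to homeomorphism its
  points can be taken in the type \<open>nat \<Rightarrow> real\<close>. The topology of \<open>K\<close> is otherwise arbitrary. Lemma
  \<open>Haar_meagerI\<close> below shows that witnesses over any other type yield the same notion.
\<close>

definition Haar_meager :: "('a, 'm) monoid_scheme \<Rightarrow> 'a topology \<Rightarrow> 'a set \<Rightarrow> bool" where
  "Haar_meager G X A \<longleftrightarrow>
     A \<subseteq> carrier G \<and>
     (\<exists>(K :: (nat \<Rightarrow> real) topology) f.
        topspace K \<noteq> {} \<and> compact_space K \<and> metrizable_space K \<and> continuous_map K X f \<and>
        (\<forall>x \<in> carrier G. \<forall>y \<in> carrier G.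
           meager_in K {k \<in> topspace K. f k \<in> (\<lambda>a. x \<otimes>\<^bsub>G\<^esub> a \<otimes>\<^bsub>G\<^esub> y) ` A}))"

lemma meager_in_homeomorphic_map:
  assumes "homeomorphic_map X Y g" "meager_in X S"
  shows "meager_in Y (g ` S)"
proof -
  have nd: "nowhere_dense_in Y (g ` N)" if "nowhere_dense_in X N" for N
  proof -
    have "Y closure_of (g ` N) = g ` (X closure_of N)"
      using homeomorphic_map_closure_of[OF assms(1)] that by (simp add: nowhere_dense_in_def)
    moreover have "Y interior_of (g ` (X closure_of N)) = g ` (X interior_of (X closure_of N))"
      using homeomorphic_map_interior_of[OF assms(1)] by (simp add: closure_of_subset_topspace)
    moreover have "g ` N \<subseteq> topspace Y"
      using that homeomorphic_imp_surjective_map[OF assms(1)] by (auto simp: nowhere_dense_in_def)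
    ultimately show ?thesis
      using that by (simp add: nowhere_dense_in_def)
  qed
  obtain N :: "nat \<Rightarrow> 'a set" where "\<And>n. nowhere_dense_in X (N n)" "S = (\<Union>n. N n)"
    using assms(2) by (auto simp: meager_in_def)
  then have "(\<forall>n. nowhere_dense_in Y (g ` N n)) \<and> g ` S = (\<Union>n. g ` N n)"
    using nd by auto
  then show ?thesis
    unfolding meager_in_def by (intro exI[of _ "\<lambda>n. g ` N n"])
qed

lemma compact_metrizable_inj:
  fixes K :: "'k topology"
  assumes "compact_space K" "metrizable_space K"
  shows "\<exists>g :: 'k \<Rightarrow> nat \<Rightarrow> real. inj_on g (topspace K)"
proof -
  obtain M d where "Metric_space M d" and K: "K = Metric_space.mtopology M d"
    using assms(2) by (auto simp: metrizable_space_def)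
  then interpret Metric_space M d by simp
  have "mtotally_bounded M"
    using assms(1) compactin_imp_mtotally_bounded by (simp add: K compact_space_def)
  then have "\<exists>C. finite C \<and> C \<subseteq> M \<and> M \<subseteq> (\<Union>x\<in>C. mball x (1 / Suc n))" for n
    by (simp add: mtotally_bounded_def)
  then obtain C where C: "\<And>n. finite (C n)" "\<And>n. C n \<subseteq> M"
      "\<And>n. M \<subseteq> (\<Union>x\<in>C n. mball x (1 / Suc n))"
    by metis
  define D where "D = (\<Union>n. C n)"
  have D: "countable D"
    unfolding D_def using C(1) by (auto intro: countable_finite)
  have "inj_on (\<lambda>x n. d x (from_nat_into D n)) M"
  proof (rule inj_onI)
    fix x y assume xy: "x \<in> M" "y \<in> M"
      and eq: "(\<lambda>n. d x (from_nat_into D n)) = (\<lambda>n. d y (from_nat_into D n))"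
    have dist: "d x c = d y c" if "c \<in> D" for c
      using fun_cong[OF eq, of "to_nat_on D c"] that D by simp
    have "d x y < 2 / Suc n" for n
    proof -
      obtain c where c: "c \<in> C n" "x \<in> mball c (1 / Suc n)"
        using C(3)[of n] xy by auto
      then have "d c x < 1 / Suc n" "c \<in> M"
        by auto
      moreover have "d x c = d y c"
        using dist c(1) by (auto simp: D_def)
      moreover have "d x y \<le> d x c + d c y"
        using xy \<open>c \<in> M\<close> by (intro triangle)
      ultimately show ?thesis
        by (simp add: commute add_divide_distrib[symmetric])
    qed
    moreover have "\<exists>n. 2 / Suc n < d x y" if "d x y > 0"
      using reals_Archimedean[of "d x y / 2"] that by (auto simp: field_simps)
    ultimately have "\<not> d x y > 0"
      using less_asym by blast
    then show "x = y"
      using xy by simp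
  qed
  then show ?thesis
    unfolding K topspace_mtopology by blast
qed

lemma Haar_meagerI:
  fixes K :: "'k topology"
  assumes "A \<subseteq> carrier G"
    and K: "topspace K \<noteq> {}" "compact_space K" "metrizable_space K"
    and f: "continuous_map K X f"
    and meager: "\<And>x y. \<lbrakk>x \<in> carrier G; y \<in> carrier G\<rbrakk> \<Longrightarrow>
       meager_in K {k \<in> topspace K. f k \<in> (\<lambda>a. x \<otimes>\<^bsub>G\<^esub> a \<otimes>\<^bsub>G\<^esub> y) ` A}"
  shows "Haar_meager G X A"
proof -
  obtain g :: "'k \<Rightarrow> nat \<Rightarrow> real" where inj: "inj_on g (topspace K)"
    using compact_metrizable_inj K by blast
  define h where "h = inv_into (topspace K) g"
  have hg: "h (g k) = k" if "k \<in> topspace K" for k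
    using inj that by (simp add: h_def)
  define L where "L = pullback_topology (g ` topspace K) h K"
  have topL: "topspace L = g ` topspace K"
    by (auto simp: L_def topspace_pullback_topology hg)
  have openL: "openin L (g ` U) \<longleftrightarrow> openin K U" if "U \<subseteq> topspace K" for U
  proof -
    have "h -` V \<inter> g ` topspace K = g ` V" if "V \<subseteq> topspace K" for V
      using that by (auto simp: hg)
    then have "openin L (g ` U) \<longleftrightarrow> (\<exists>V. openin K V \<and> g ` U = g ` V)"
      by (metis L_def openin_pullback_topology openin_subset)
    then show ?thesis
      using inj that by (metis inj_on_image_eq_iff openin_subset)
  qed
  have hom: "homeomorphic_map K L g"
  proof (rule bijective_open_imp_homeomorphic_map)
    show "continuous_map K L g"
      unfolding continuous_map
    proof (intro conjI allI impI)
      fix U assume "openin L U"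
      then obtain V where V: "openin K V" "U = h -` V \<inter> g ` topspace K"
        by (auto simp: L_def openin_pullback_topology)
      then have "{x \<in> topspace K. g x \<in> U} = V"
        using openin_subset[OF V(1)] hg by (auto simp del: imageE) (metis hg subsetD)
      with V show "openin K {x \<in> topspace K. g x \<in> U}" by simp
    qed (simp add: topL)
    show "open_map K L g"
      using openL openin_subset by (auto simp: open_map_def)
  qed (use inj topL in auto)
  then have "K homeomorphic_space L"
    by (rule homeomorphic_map_imp_homeomorphic_space)
  then have "topspace L \<noteq> {}" "compact_space L" "metrizable_space L"
    using K topL homeomorphic_compact_space homeomorphic_metrizable_space by (auto, blast+)
  moreover have "continuous_map L X (f \<circ> h)"
    unfolding L_def using f by (rule continuous_map_pullback)
  moreover have "meager_in L {l \<in> topspace L. (f \<circ> h) l \<in> (\<lambda>a. x \<otimes>\<^bsub>G\<^esub> a \<otimes>\<^bsub>G\<^esub> y) ` A}"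
    if "x \<in> carrier G" "y \<in> carrier G" for x y
  proof -
    have "{l \<in> topspace L. (f \<circ> h) l \<in> (\<lambda>a. x \<otimes>\<^bsub>G\<^esub> a \<otimes>\<^bsub>G\<^esub> y) ` A} =
        g ` {k \<in> topspace K. f k \<in> (\<lambda>a. x \<otimes>\<^bsub>G\<^esub> a \<otimes>\<^bsub>G\<^esub> y) ` A}"
      unfolding topL by (auto simp: hg)
    then show ?thesis
      using meager_in_homeomorphic_map[OF hom meager[OF that]] by simp
  qed
  ultimately show ?thesis
    unfolding Haar_meager_def using assms(1) by blast
qed

definition prethick :: "('a, 'm) monoid_scheme \<Rightarrow> 'a topology \<Rightarrow> 'a set \<Rightarrow> bool" where
  "prethick G X T \<longleftrightarrow>
     T \<subseteq> carrier G \<and>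
     (\<forall>K. compactin X K \<longrightarrow>
        (\<exists>F. finite F \<and> F \<subseteq> carrier G \<and>
             K \<subseteq> {a \<otimes>\<^bsub>G\<^esub> t \<otimes>\<^bsub>G\<^esub> b | a t b. a \<in> F \<and> t \<in> T \<and> b \<in> F}))"


section \<open>The group of integer sequences\<close>

definition int_seq_group :: "(nat \<Rightarrow> int) monoid" where
  "int_seq_group = product_group UNIV (\<lambda>_. integer_group)"

definition int_seq_topology :: "(nat \<Rightarrow> int) topology" where
  "int_seq_topology = product_topology (\<lambda>_. discrete_topology UNIV) UNIV"

lemma carrier_int_seq_group [simp]: "carrier int_seq_group = UNIV"
  by (auto simp: int_seq_group_def PiE_def)

lemma mult_int_seq_group [simp]: "x \<otimes>\<^bsub>int_seq_group\<^esub> y = (\<lambda>n. x n + y n)"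
  by (auto simp: int_seq_group_def)

lemma one_int_seq_group [simp]: "\<one>\<^bsub>int_seq_group\<^esub> = (\<lambda>n. 0)"
  by (auto simp: int_seq_group_def)

lemma group_int_seq_group: "group int_seq_group"
  unfolding int_seq_group_def by (rule product_group) simp

lemma inv_int_seq_group [simp]: "inv\<^bsub>int_seq_group\<^esub> x = (\<lambda>n. - x n)"
  by (rule group.inv_equality[OF group_int_seq_group]) auto

lemma topspace_int_seq_topology [simp]: "topspace int_seq_topology = UNIV"
  by (auto simp: int_seq_topology_def PiE_def)

lemma int_seq_topology_eq_euclidean: "int_seq_topology = euclidean"
proof -
  have "discrete_topology UNIV = (euclidean :: int topology)"
    by (auto simp: topology_eq open_discrete)
  then show ?thesis
    by (simp add: int_seq_topology_def euclidean_product_topology)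
qed

lemma Polish_group_int_seq: "Polish_group int_seq_group int_seq_topology"
proof -
  have coord: "continuous_map int_seq_topology (discrete_topology UNIV) (\<lambda>x. x n)" for n
    unfolding int_seq_topology_def by (rule continuous_map_product_projection) simp
  have "continuous_map (prod_topology int_seq_topology int_seq_topology)
          (discrete_topology UNIV) (\<lambda>p. fst p n + snd p n)" for n
  proof -
    let ?D = "discrete_topology (UNIV :: int set)"
    have "continuous_map (prod_topology int_seq_topology int_seq_topology)
            (prod_topology ?D ?D) (\<lambda>p. (fst p n, snd p n))"
      using continuous_map_compose[OF continuous_map_fst coord[of n]]
            continuous_map_compose[OF continuous_map_snd coord[of n]]
      by (auto simp: continuous_map_pairwise o_def)
    moreover have "continuous_map (prod_topology ?D ?D) ?D (\<lambda>(a, b). a + b)"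
      by (simp flip: prod_topology_discrete_topology)
    ultimately show ?thesis
      by (auto dest: continuous_map_compose simp: o_def)
  qed
  then have mult: "continuous_map (prod_topology int_seq_topology int_seq_topology)
      int_seq_topology (\<lambda>(x, y). x \<otimes>\<^bsub>int_seq_group\<^esub> y)"
    by (simp add: int_seq_topology_def continuous_map_componentwise_UNIV case_prod_beta)
  have "continuous_map int_seq_topology (discrete_topology UNIV) (\<lambda>x. - x n)" for n
    using continuous_map_compose[OF coord[of n], of "discrete_topology UNIV" uminus]
    by (simp add: o_def)
  then have inv: "continuous_map int_seq_topology int_seq_topology
      (\<lambda>x. inv\<^bsub>int_seq_group\<^esub> x)"
    by (simp add: int_seq_topology_def continuous_map_componentwise_UNIV)
  have "second_countable int_seq_topology"
    unfolding second_countable_def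
  proof (intro exI conjI ballI allI impI)
    let ?cyl = "\<lambda>l :: int list. {x :: nat \<Rightarrow> int. \<forall>i < length l. x i = l ! i}"
    show "countable (range ?cyl)" by simp
    show "openin int_seq_topology V" if V: "V \<in> range ?cyl" for V
    proof -
      obtain l where l: "V = ?cyl l" using V by auto
      have "V = (\<Pi>\<^sub>E i\<in>UNIV. if i < length l then {l ! i} else UNIV)"
        unfolding l by (auto simp: PiE_iff split: if_splits)
      moreover have "{i. (if i < length l then {l ! i} else UNIV) \<noteq> (UNIV :: int set)} \<subseteq> {..<length l}"
        by (auto split: if_splits)
      then have "finite {i. (if i < length l then {l ! i} else UNIV) \<noteq> (UNIV :: int set)}"
        by (rule finite_subset) simp
      ultimately show ?thesis
        by (simp add: int_seq_topology_def openin_PiE_gen)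
    qed
    fix U and x :: "nat \<Rightarrow> int" assume "openin int_seq_topology U \<and> x \<in> U"
    then obtain W where W: "finite {i. W i \<noteq> (UNIV :: int set)}" "x \<in> Pi\<^sub>E UNIV W" "Pi\<^sub>E UNIV W \<subseteq> U"
      unfolding int_seq_topology_def openin_product_topology_alt by fastforce
    obtain m where m: "\<And>i. W i \<noteq> UNIV \<Longrightarrow> i < m"
      using W(1) finite_nat_set_iff_bounded by auto
    have "?cyl (map x [0..<m]) \<subseteq> U"
    proof
      fix y assume "y \<in> ?cyl (map x [0..<m])"
      then have "y i \<in> W i" for i
        using m[of i] W(2) by (cases "i < m") (auto simp: PiE_iff)
      then show "y \<in> U" using W(3) by (auto simp: PiE_iff)
    qed
    moreover have "x \<in> ?cyl (map x [0..<m])" by simp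
    ultimately show "\<exists>V \<in> range ?cyl. x \<in> V \<and> V \<subseteq> U" by blast
  qed
  then have "Polish_space int_seq_topology"
    by (simp add: Polish_space_def second_countable_imp_separable_space)
       (simp add: int_seq_topology_def completely_metrizable_space_product_topology
          completely_metrizable_space_discrete_topology)
  with mult inv group_int_seq_group show ?thesis
    by (simp add: Polish_group_def topological_group_def)
qed

end

theory Submission
  imports Defs
begin

text \<open>
  The subgroup is generated by a set of sequences that constantly encode their own past. Fix very
  sparse centres in the integers, surrounded by disjoint intervals whose radii tend to infinity. In
  an admissible sequence every entry lies in one of these intervals, and the index of the interval
  names an initial segment of the sequence, never a shorter one than earlier entries did. The
  generators are the admissible sequences that name arbitrarily long initial segments; the other
  admissible sequences are called stalled. Being stalled with a given bound is a closed condition,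
  so the generators form a \<open>G\<^sub>\<delta>\<close>-set (\<open>gdelta_generators\<close>).

  The generators are independent in a strong sense. Two distinct generators eventually name
  different initial segments (\<open>codes_eventually_differ\<close>), so from some time on the entries of
  finitely many generators lie in different intervals. The centres grow so fast that then the entry
  of largest index dominates any combination with coefficients bounded by the time
  (\<open>code_less_abs_sum\<close>). Hence a non-trivial combination has finitely many zeros
  (\<open>finite_zeros_lin_comb\<close>), and a subgroup of such sequences is meager.

  Domination also bounds the terms by the value of the combination. So the combination map sends
  closed sets of tuples with distinct codes from a given time on to closed sets
  (\<open>closed_tuple_comb_image\<close>). Such tuples of admissible sequences yield countably many closed sets
  that cover the subgroup, and the subgroup meets each of them in the complement of the images of
  the tuples with a stalled member (\<open>lin_combs_Int_tuple_combs\<close>). These images are countably many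
  closed sets, so the pieces are \<open>G\<^sub>\<delta>\<close>-sets, thus Polish.

  The freedom to move within the intervals gives the prethick closures. A sequence that names the
  same initial segment forever may follow any point of a given compact set inside intervals of
  large radius. It is stalled, but it is a limit of generators, which follow it for a long time and
  then start to name everything (\<open>prethick_closure\<close>). A closed Haar-meager set cannot contain a
  prethick set (\<open>prethick_not_Haar_meager\<close>), so Baire's theorem for the generators shows that
  countably many such sets do not cover the subgroup (\<open>generators_not_covered\<close>).
\<close>

section \<open>Integers as sparse codes\<close>

text \<open>
  The recursive equation is exactly what domination needs: with weights of total size at most
  \<open>Suc c\<close>, all terms of code at most \<open>c\<close> add up to at most \<open>Suc c * (centre c + c)\<close>, and one term
  of code \<open>Suc c\<close> exceeds this by more than \<open>Suc c\<close>.
\<close>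

fun centre :: "nat \<Rightarrow> nat" where
  "centre 0 = 1"
| "centre (Suc c) = Suc c * (centre c + c) + 2 * Suc c + 1"

lemma centre_gap: "i < j \<Longrightarrow> centre i + i + j < centre j"
proof (induction j)
  case (Suc j)
  have "centre i + i \<le> centre j + j"
    using Suc by (cases "i = j") auto
  then show ?case by simp
qed simp

lemma mono_centre: "i \<le> j \<Longrightarrow> centre i + i \<le> centre j + j"
  using centre_gap[of i j] by (cases "i = j") auto

text \<open>
  The intervals of radius \<open>c\<close> around \<open>centre c\<close> are pairwise disjoint and increasing, so the code
  of a member of their union can be read off from the right end points.
\<close>

definition code :: "int \<Rightarrow> nat" where
  "code x = (LEAST c. x \<le> int (centre c + c))"

definition near_centre :: "int \<Rightarrow> bool" where
  "near_centre x \<longleftrightarrow> \<bar>x - int (centre (code x))\<bar> \<le> int (code x)"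

lemma code_eqI:
  assumes "\<bar>x - int (centre c)\<bar> \<le> int c"
  shows "code x = c"
  unfolding code_def
proof (rule Least_equality)
  show "x \<le> int (centre c + c)" using assms by linarith
  show "c \<le> i" if "x \<le> int (centre i + i)" for i
    using that assms centre_gap[of i c] by (cases "i < c") auto
qed

lemma near_centreI: "\<bar>x - int (centre c)\<bar> \<le> int c \<Longrightarrow> near_centre x"
  using code_eqI by (simp add: near_centre_def)

lemma near_centre_abs_le: "near_centre x \<Longrightarrow> \<bar>x\<bar> \<le> int (centre (code x) + code x)"
  by (simp add: near_centre_def abs_le_iff)

text \<open>
  The term of largest code outweighs all the others together, even after its weight and its
  deviation from the centre are chosen as badly as possible. A strict bound by the codes gives more
  than non-vanishing of the sum: it makes the set of tuples with a prescribed sum finite, which is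
  the source of the closedness results below.
\<close>

lemma code_less_abs_sum:
  fixes a x :: "'i \<Rightarrow> int"
  assumes "finite I" and near: "\<And>i. i \<in> I \<Longrightarrow> near_centre (x i)"
    and nz: "\<And>i. i \<in> I \<Longrightarrow> a i \<noteq> 0"
    and inj: "inj_on (\<lambda>i. code (x i)) I"
    and n: "(\<Sum>i\<in>I. \<bar>a i\<bar>) \<le> int n" "\<And>i. i \<in> I \<Longrightarrow> n \<le> code (x i)"
    and "i \<in> I"
  shows "int (code (x i)) < \<bar>\<Sum>i\<in>I. a i * x i\<bar>"
proof -
  define M where "M = Max ((\<lambda>i. code (x i)) ` I)"
  have "M \<in> (\<lambda>i. code (x i)) ` I"
    unfolding M_def using assms by (intro Max_in) auto
  then obtain k where k: "k \<in> I" "code (x k) = M" by auto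
  have le_M: "code (x i) \<le> M" if "i \<in> I" for i
    unfolding M_def using that \<open>finite I\<close> by simp
  have split: "(\<Sum>i\<in>I. g i) = g k + (\<Sum>i\<in>I-{k}. g i)" for g :: "'i \<Rightarrow> int"
    using k \<open>finite I\<close> by (simp add: sum.remove)
  have "\<bar>a k\<bar> \<ge> 1" using nz[OF k(1)] by linarith
  moreover have "(\<Sum>i\<in>I-{k}. \<bar>a i\<bar>) \<ge> 0" by (simp add: sum_nonneg)
  ultimately have "n \<ge> 1" using n(1) split[of "\<lambda>i. \<bar>a i\<bar>"] by linarith
  then obtain j where j: "M = Suc j" using n(2)[OF k(1)] k(2) by (cases M) auto
  have rest: "\<bar>x i\<bar> \<le> int (centre j + j)" if "i \<in> I - {k}" for i
  proof -
    have "code (x i) \<noteq> M" using that k inj by (auto dest: inj_onD)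
    then have "code (x i) \<le> j" using le_M[of i] that j by auto
    then show ?thesis using near_centre_abs_le[OF near, of i] mono_centre[of "code (x i)" j] that by force
  qed
  have "\<bar>\<Sum>i\<in>I-{k}. a i * x i\<bar> \<le> (\<Sum>i\<in>I-{k}. \<bar>a i\<bar> * int (centre j + j))"
    using rest by (intro order_trans[OF sum_abs] sum_mono) (auto simp: abs_mult intro!: mult_left_mono)
  also have "\<dots> = (\<Sum>i\<in>I-{k}. \<bar>a i\<bar>) * int (centre j + j)"
    by (simp add: sum_distrib_right)
  also have "\<dots> \<le> int M * int (centre j + j)"
    using split[of "\<lambda>i. \<bar>a i\<bar>"] n(1) n(2)[OF k(1)] k(2) \<open>\<bar>a k\<bar> \<ge> 1\<close>
    by (intro mult_right_mono) auto
  finally have small: "\<bar>\<Sum>i\<in>I-{k}. a i * x i\<bar> \<le> int (M * (centre j + j))" by simp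
  have "int (centre M) - int M \<le> \<bar>x k\<bar>"
    using near[OF k(1)] unfolding near_centre_def k(2) by linarith
  also have "\<dots> \<le> \<bar>a k * x k\<bar>"
    using \<open>\<bar>a k\<bar> \<ge> 1\<close> mult_right_mono[of 1 "\<bar>a k\<bar>" "\<bar>x k\<bar>"] by (simp add: abs_mult)
  finally have big: "int (centre M) - int M \<le> \<bar>a k * x k\<bar>" .
  have "int (centre M) = int (M * (centre j + j)) + 2 * int M + 1"
    by (simp add: j)
  then have "int M < \<bar>a k * x k\<bar> - \<bar>\<Sum>i\<in>I-{k}. a i * x i\<bar>"
    using big small by linarith
  also have "\<dots> \<le> \<bar>\<Sum>i\<in>I. a i * x i\<bar>"
    using split[of "\<lambda>i. a i * x i"] by linarith
  finally show ?thesis using le_M[OF \<open>i \<in> I\<close>] by linarith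
qed

section \<open>Admissible sequences and the generating set\<close>

text \<open>
  A code holds a pair of a finite sequence and a natural number; the number only serves to make the
  radius of the interval as large as desired.
\<close>

definition label :: "int \<Rightarrow> int list" where
  "label x = from_nat (fst (prod_decode (code x)))"

text \<open>
  Each label announces an initial segment of the sequence itself. Labels of length at most \<open>n\<close> at
  time \<open>n\<close> make this a condition on prefixes, so that an entry can be chosen from the previous ones.
  As the lengths never decrease, they tend to infinity once they are unbounded, which is a
  \<open>G\<^sub>\<delta>\<close>-condition.
\<close>

definition admissible :: "(nat \<Rightarrow> int) \<Rightarrow> nat \<Rightarrow> bool" where
  "admissible y n \<longleftrightarrow> near_centre (y n) \<and> n \<le> code (y n) \<and> length (label (y n)) \<le> n \<and>
     (\<forall>d < length (label (y n)). label (y n) ! d = y d) \<and>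
     (\<forall>m\<le>n. length (label (y m)) \<le> length (label (y n)))"

definition admissible_seqs :: "(nat \<Rightarrow> int) set" where
  "admissible_seqs = {y. \<forall>n. admissible y n}"

text \<open>
  A stalled sequence never reveals itself beyond some initial segment, so distinct stalled sequences
  may agree at infinitely many times and have to be kept out of the generating set. As limits of
  generators they come back in its closure, and this makes the closure large.
\<close>

definition stalled :: "nat \<Rightarrow> (nat \<Rightarrow> int) set" where
  "stalled K = {y \<in> admissible_seqs. \<forall>n. length (label (y n)) \<le> K}"

definition generators :: "(nat \<Rightarrow> int) set" where
  "generators = admissible_seqs - (\<Union>K. stalled K)"

lemma generators_admissible: "p \<in> generators \<Longrightarrow> p \<in> admissible_seqs"
  by (simp add: generators_def)

lemma admissible_cong:
  assumes "\<And>i. i \<le> n \<Longrightarrow> y i = z i" 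
  shows "admissible y n \<longleftrightarrow> admissible z n"
  using assms by (auto simp: admissible_def)

lemma generators_label_grows:
  assumes "p \<in> generators"
  shows "\<exists>N. \<forall>n\<ge>N. d < length (label (p n))"
proof -
  have p: "admissible p n" for n using assms by (auto simp: generators_def admissible_seqs_def)
  obtain N where "d < length (label (p N))"
    using assms by (auto simp: generators_def stalled_def not_le)
  then show ?thesis using p by (meson admissible_def less_le_trans)
qed

text \<open>
  Equal codes carry equal labels, and a label that is long enough tells the two sequences apart.
  One non-stalling sequence is enough for this.
\<close>

lemma codes_eventually_differ:
  assumes "p \<in> generators" "q \<in> admissible_seqs" "p \<noteq> q"
  shows "\<exists>N. \<forall>n\<ge>N. code (p n) \<noteq> code (q n)"
proof -
  obtain d where d: "p d \<noteq> q d" using assms(3) by auto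
  obtain N where N: "\<And>n. n \<ge> N \<Longrightarrow> d < length (label (p n))"
    using generators_label_grows[OF assms(1)] by blast
  have "code (p n) \<noteq> code (q n)" if "n \<ge> N" for n
  proof
    assume "code (p n) = code (q n)"
    then have "label (p n) = label (q n)" by (simp add: label_def)
    moreover have "admissible p n" "admissible q n"
      using assms by (auto simp: generators_def admissible_seqs_def)
    ultimately have "label (p n) ! d = p d" "label (p n) ! d = q d"
      using N[OF that] by (simp_all add: admissible_def)
    then show False using d by simp
  qed
  then show ?thesis by blast
qed

section \<open>Integer combinations of generators\<close>

definition lin_comb :: "((nat \<Rightarrow> int) \<Rightarrow> int) \<Rightarrow> (nat \<Rightarrow> int) set \<Rightarrow> nat \<Rightarrow> int" where
  "lin_comb a Q = (\<lambda>n. \<Sum>q\<in>Q. a q * q n)"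

text \<open>
  Stated for admissible sequences, not only for generators: it is also applied to combinations with
  stalled terms, as long as their codes are pairwise eventually distinct.
\<close>

lemma finite_zeros_lin_comb:
  assumes "finite Q" "Q \<subseteq> admissible_seqs"
    and apart: "\<And>p q. p \<in> Q \<Longrightarrow> q \<in> Q \<Longrightarrow> p \<noteq> q \<Longrightarrow> \<exists>N. \<forall>n\<ge>N. code (p n) \<noteq> code (q n)"
    and "r \<in> Q" "a r \<noteq> 0"
  shows "finite {n. lin_comb a Q n = 0}"
proof -
  define R where "R = {q \<in> Q. a q \<noteq> 0}"
  have R: "finite R" "R \<subseteq> Q" "r \<in> R" "\<And>q. q \<in> R \<Longrightarrow> a q \<noteq> 0"
    using assms by (auto simp: R_def)
  obtain N where N: "\<And>p q n. p \<in> Q \<Longrightarrow> q \<in> Q \<Longrightarrow> p \<noteq> q \<Longrightarrow> n \<ge> N p q \<Longrightarrow> code (p n) \<noteq> code (q n)"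
    using apart by metis
  define M where "M = Max ((\<lambda>(p, q). N p q) ` (Q \<times> Q))"
  have M: "N p q \<le> M" if "p \<in> Q" "q \<in> Q" for p q
    unfolding M_def using that \<open>finite Q\<close> by (intro Max_ge) auto
  define B where "B = nat (\<Sum>q\<in>R. \<bar>a q\<bar>)"
  have "lin_comb a Q n \<noteq> 0" if "n \<ge> M" "n \<ge> B" for n
  proof -
    have "lin_comb a Q n = (\<Sum>q\<in>R. a q * q n)"
      unfolding lin_comb_def R_def using \<open>finite Q\<close> by (intro sum.mono_neutral_right) auto
    moreover have "int (code (r n)) < \<bar>\<Sum>q\<in>R. a q * q n\<bar>"
    proof (rule code_less_abs_sum[where n=n])
      show "inj_on (\<lambda>q. code (q n)) R"
      proof (rule inj_onI, rule ccontr)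
        fix p q assume pq: "p \<in> R" "q \<in> R" "code (p n) = code (q n)" "p \<noteq> q"
        then have "n \<ge> N p q" using M[of p q] R(2) that(1) by fastforce
        then show False using N[of p q n] pq R(2) by blast
      qed
      show "(\<Sum>q\<in>R. \<bar>a q\<bar>) \<le> int n" using that by (simp add: B_def)
    qed (use R assms(2) in \<open>auto simp: admissible_seqs_def admissible_def\<close>)
    ultimately show ?thesis by auto
  qed
  then have "{n. lin_comb a Q n = 0} \<subseteq> {..<max M B}"
    by (metis (mono_tags, lifting) lessThan_iff max.bounded_iff mem_Collect_eq not_le subsetI)
  then show ?thesis by (rule finite_subset) simp
qed

definition lin_combs :: "(nat \<Rightarrow> int) set" where
  "lin_combs = {lin_comb a Q | a Q. finite Q \<and> Q \<subseteq> generators}"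

lemma lin_comb_support:
  assumes "finite Q" "Q \<subseteq> R" "finite R"
  shows "lin_comb a Q = lin_comb (\<lambda>q. if q \<in> Q then a q else 0) R"
proof
  fix n
  have "(\<Sum>q\<in>R. (if q \<in> Q then a q else 0) * q n) = (\<Sum>q\<in>Q. (if q \<in> Q then a q else 0) * q n)"
    using assms by (intro sum.mono_neutral_right) auto
  then show "lin_comb a Q n = lin_comb (\<lambda>q. if q \<in> Q then a q else 0) R n"
    by (simp add: lin_comb_def)
qed

lemma lin_comb_diff: "lin_comb (\<lambda>q. a q - b q) Q n = lin_comb a Q n - lin_comb b Q n"
  by (simp add: lin_comb_def left_diff_distrib sum_subtractf)

lemma finite_zeros_lin_combs:
  assumes "z \<in> lin_combs"
  shows "z = (\<lambda>n. 0) \<or> finite {n. z n = 0}"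
proof -
  obtain a Q where Q: "finite Q" "Q \<subseteq> generators" and z: "z = lin_comb a Q"
    using assms by (auto simp: lin_combs_def)
  show ?thesis
  proof (cases "\<exists>r\<in>Q. a r \<noteq> 0")
    case True
    then show ?thesis
    proof -
      obtain r where "r \<in> Q" "a r \<noteq> 0" using True by blast
      moreover have "Q \<subseteq> admissible_seqs" using Q(2) generators_admissible by blast
      moreover have "\<exists>N. \<forall>n\<ge>N. code (p n) \<noteq> code (q n)" if "p \<in> Q" "q \<in> Q" "p \<noteq> q" for p q
        using that Q(2) \<open>Q \<subseteq> admissible_seqs\<close> by (intro codes_eventually_differ) auto
      ultimately have "finite {n. lin_comb a Q n = 0}"
        using Q(1) by (intro finite_zeros_lin_comb) auto
      then show ?thesis by (simp add: z)
    qed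
  next
    case False
    then show ?thesis by (simp add: z lin_comb_def)
  qed
qed

lemma lin_combs_diff:
  assumes "z \<in> lin_combs" "w \<in> lin_combs"
  shows "(\<lambda>n. z n - w n) \<in> lin_combs"
proof -
  obtain a Q where Q: "finite Q" "Q \<subseteq> generators" "z = lin_comb a Q"
    using assms by (auto simp: lin_combs_def)
  obtain b R where R: "finite R" "R \<subseteq> generators" "w = lin_comb b R"
    using assms by (auto simp: lin_combs_def)
  show ?thesis
  proof -
    let ?a = "\<lambda>q. if q \<in> Q then a q else 0" and ?b = "\<lambda>q. if q \<in> R then b q else 0"
    have "(\<lambda>n. z n - w n) = lin_comb (\<lambda>q. ?a q - ?b q) (Q \<union> R)"
      using lin_comb_support[of Q "Q \<union> R" a] lin_comb_support[of R "Q \<union> R" b] Q R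
      by (simp add: lin_comb_diff fun_eq_iff)
    moreover have "finite (Q \<union> R)" "Q \<union> R \<subseteq> generators" using Q R by auto
    ultimately show ?thesis unfolding lin_combs_def by blast
  qed
qed

lemma zero_lin_combs: "(\<lambda>n. 0) \<in> lin_combs"
  unfolding lin_combs_def by (rule CollectI, rule exI[of _ "\<lambda>_. 0"], rule exI[of _ "{}"]) (simp add: lin_comb_def)

lemma subgroup_lin_combs: "subgroup lin_combs int_seq_group"
proof (rule group.subgroupI[OF group_int_seq_group])
  fix z w assume "z \<in> lin_combs" "w \<in> lin_combs"
  then show "z \<otimes>\<^bsub>int_seq_group\<^esub> w \<in> lin_combs"
    using lin_combs_diff[OF \<open>z \<in> lin_combs\<close> lin_combs_diff[OF zero_lin_combs \<open>w \<in> lin_combs\<close>]] by simp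
qed (use zero_lin_combs lin_combs_diff[OF zero_lin_combs] in auto)

lemma multiple_in_subgroup:
  assumes "subgroup K int_seq_group" "z \<in> K"
  shows "(\<lambda>n. (c::int) * z n) \<in> K"
proof (induction c rule: int_induct[where k=0])
  case base
  show ?case using subgroup.one_closed[OF assms(1)] by simp
next
  case (step1 i)
  then show ?case
    using subgroup.m_closed[OF assms(1) step1(2) assms(2)] by (simp add: algebra_simps)
next
  case (step2 i)
  then show ?case
    using subgroup.m_closed[OF assms(1) step2(2) subgroup.m_inv_closed[OF assms]]
    by (simp add: algebra_simps)
qed

lemma lin_combs_eq_generate: "lin_combs = generate int_seq_group generators"
proof (rule group.generateI[OF group_int_seq_group subgroup_lin_combs])
  show "generators \<subseteq> lin_combs"
  proof
    fix p assume "p \<in> generators"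
    moreover have "p = lin_comb (\<lambda>_. 1) {p}" by (simp add: lin_comb_def)
    ultimately show "p \<in> lin_combs" unfolding lin_combs_def by blast
  qed
  fix K assume K: "subgroup K int_seq_group" "generators \<subseteq> K"
  have "lin_comb a Q \<in> K" if "finite Q" "Q \<subseteq> generators" for a Q
    using that
  proof (induction Q rule: finite_induct)
    case empty
    show ?case using subgroup.one_closed[OF K(1)] by (simp add: lin_comb_def)
  next
    case (insert q Q)
    then have "lin_comb a (insert q Q) = (\<lambda>n. a q * q n + lin_comb a Q n)"
      by (simp add: lin_comb_def)
    moreover have "(\<lambda>n. a q * q n) \<in> K"
      using insert.prems K by (intro multiple_in_subgroup) auto
    ultimately show ?case
      using subgroup.m_closed[OF K(1), of "\<lambda>n. a q * q n" "lin_comb a Q"] insert by simp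
  qed
  then show "lin_combs \<subseteq> K" by (auto simp: lin_combs_def)
qed

section \<open>The topology of integer sequences\<close>

lemma closed_continuous_int_relation:
  fixes f g :: "'a::topological_space \<Rightarrow> int"
  assumes "continuous_on UNIV f" "continuous_on UNIV g"
  shows "closed {x. R (f x) (g x)}"
proof -
  have "open (f -` {u} \<inter> g -` {v})" for u v
    using assms by (intro open_Int continuous_on_open_vimage[THEN iffD1, rule_format, of UNIV, simplified])
      (auto simp: open_discrete continuous_on_open_vimage)
  then have "open (\<Union>(u, v) \<in> {(u, v). \<not> R u v}. f -` {u} \<inter> g -` {v})"
    by auto
  moreover have "(\<Union>(u, v) \<in> {(u, v). \<not> R u v}. f -` {u} \<inter> g -` {v}) = - {x. R (f x) (g x)}"
    by auto
  ultimately show ?thesis by (simp add: closed_def)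
qed

lemma closed_coordinates: "closed {y :: nat \<Rightarrow> int. R (y m) (y n)}"
  by (intro closed_continuous_int_relation continuous_on_product_coordinates)

lemma closed_admissible_seqs: "closed admissible_seqs"
proof -
  have "closed {y :: nat \<Rightarrow> int. near_centre (y n) \<and> n \<le> code (y n) \<and> length (label (y n)) \<le> n}" for n
    by (rule closed_coordinates[of "\<lambda>u v. near_centre u \<and> n \<le> code u \<and> length (label u) \<le> n" n n])
  moreover have "closed {y :: nat \<Rightarrow> int. d < length (label (y n)) \<longrightarrow> label (y n) ! d = y d}" for n d
    by (rule closed_coordinates[of "\<lambda>u v. d < length (label u) \<longrightarrow> label u ! d = v"])
  moreover have "closed {y :: nat \<Rightarrow> int. length (label (y m)) \<le> length (label (y n))}" for m n
    by (rule closed_coordinates)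
  ultimately have "closed (\<Inter>n. {y. near_centre (y n) \<and> n \<le> code (y n) \<and> length (label (y n)) \<le> n} \<inter>
      (\<Inter>d. {y. d < length (label (y n)) \<longrightarrow> label (y n) ! d = y d}) \<inter>
      (\<Inter>m\<in>{..n}. {y. length (label (y m)) \<le> length (label (y n))}))"
    by (intro closed_INT closed_Int ballI)
  also have "(\<Inter>n. {y. near_centre (y n) \<and> n \<le> code (y n) \<and> length (label (y n)) \<le> n} \<inter>
      (\<Inter>d. {y. d < length (label (y n)) \<longrightarrow> label (y n) ! d = y d}) \<inter>
      (\<Inter>m\<in>{..n}. {y. length (label (y m)) \<le> length (label (y n))})) = admissible_seqs"
    by (auto simp: admissible_seqs_def admissible_def)
  finally show ?thesis .
qed

lemma closed_stalled: "closed (stalled K)"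
proof -
  have "stalled K = admissible_seqs \<inter> (\<Inter>n. {y. length (label (y n)) \<le> K})"
    by (auto simp: stalled_def)
  then show ?thesis
    using closed_admissible_seqs closed_coordinates[of "\<lambda>u v. length (label u) \<le> K"]
    by (auto intro!: closed_INT closed_Int)
qed

lemma metrizable_int_seq: "metrizable_space (euclidean :: (nat \<Rightarrow> int) topology)"
  using Polish_group_int_seq completely_metrizable_imp_metrizable_space
  by (auto simp: Polish_group_def Polish_space_def int_seq_topology_eq_euclidean)

lemma gdelta_closed_diff:
  fixes C :: "(nat \<Rightarrow> int) set"
  assumes "closed C" "\<And>i::nat. closed (D i)"
  shows "gdelta_in int_seq_topology (C - (\<Union>i. D i))"
  unfolding int_seq_topology_eq_euclidean
  using assms metrizable_int_seq
  by (intro gdelta_in_diff closed_imp_gdelta_in fsigma_in_Union) (auto intro: closed_imp_fsigma_in)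

lemma gdelta_generators: "gdelta_in int_seq_topology generators"
  unfolding generators_def by (intro gdelta_closed_diff closed_admissible_seqs closed_stalled)

lemma open_contains_cylinder:
  fixes W :: "(nat \<Rightarrow> int) set"
  assumes "open W" "x \<in> W"
  shows "\<exists>j. \<forall>y. (\<forall>i<j. y i = x i) \<longrightarrow> y \<in> W"
proof -
  obtain U where U: "x \<in> Pi\<^sub>E UNIV U" "finite {i. U i \<noteq> UNIV}" "Pi\<^sub>E UNIV U \<subseteq> W"
    using product_topology_open_contains_basis[of "\<lambda>_. euclidean :: int topology" UNIV W x] assms
    by (auto simp: open_fun_def)
  obtain j where j: "\<And>i. U i \<noteq> UNIV \<Longrightarrow> i < j"
    using U(2) finite_nat_set_iff_bounded by auto
  have "y \<in> W" if "\<forall>i<j. y i = x i" for y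
  proof -
    have "y i \<in> U i" for i
      using j[of i] that U(1) by (cases "i < j") (auto simp: PiE_iff)
    then show ?thesis using U(3) by (auto simp: PiE_iff)
  qed
  then show ?thesis by blast
qed

lemma open_cylinder: "open {y :: nat \<Rightarrow> int. \<forall>i<j. y i = x i}"
proof -
  have "closed {y :: nat \<Rightarrow> int. y i \<noteq> x i}" for i
    by (rule closed_coordinates[of "\<lambda>u v. u \<noteq> x i" i i])
  then have "open (\<Inter>i\<in>{..<j}. - {y :: nat \<Rightarrow> int. y i \<noteq> x i})"
    by (intro open_INT) auto
  moreover have "(\<Inter>i\<in>{..<j}. - {y :: nat \<Rightarrow> int. y i \<noteq> x i}) = {y. \<forall>i<j. y i = x i}"
    by auto
  ultimately show ?thesis by simp
qed

lemma in_closure_iff_cylinder: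
  fixes x :: "nat \<Rightarrow> int"
  shows "x \<in> closure S \<longleftrightarrow> (\<forall>j. \<exists>y\<in>S. \<forall>i<j. y i = x i)"
proof
  show "\<forall>j. \<exists>y\<in>S. \<forall>i<j. y i = x i" if "x \<in> closure S"
  proof
    fix j
    have "x \<in> {y. \<forall>i<j. y i = x i}" by simp
    then have "{y. \<forall>i<j. y i = x i} \<inter> S \<noteq> {}"
      using that open_Int_closure_eq_empty[OF open_cylinder] by blast
    then show "\<exists>y\<in>S. \<forall>i<j. y i = x i" by blast
  qed
  show "x \<in> closure S" if "\<forall>j. \<exists>y\<in>S. \<forall>i<j. y i = x i"
  proof (rule ccontr)
    assume "x \<notin> closure S"
    then obtain j where "\<forall>y. (\<forall>i<j. y i = x i) \<longrightarrow> y \<in> - closure S"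
      using open_contains_cylinder[of "- closure S" x] by auto
    with that show False using closure_subset by blast
  qed
qed

lemma gdelta_imp_Polish:
  assumes "gdelta_in int_seq_topology S"
  shows "Polish_space (subtopology int_seq_topology S)"
  unfolding Polish_space_def
proof
  show "completely_metrizable_space (subtopology int_seq_topology S)"
    using assms Polish_group_int_seq completely_metrizable_space_gdelta_in
    by (auto simp: Polish_group_def Polish_space_def)
  define e where "e l = (SOME y. y \<in> S \<and> (\<forall>i<length l. y i = l ! i))" for l
  define T where "T = e ` {l. \<exists>y. y \<in> S \<and> (\<forall>i<length l. y i = l ! i)}"
  have e: "e l \<in> S \<and> (\<forall>i<length l. e l i = l ! i)"
    if "y \<in> S \<and> (\<forall>i<length l. y i = l ! i)" for l y
    unfolding e_def using someI[of "\<lambda>y. y \<in> S \<and> (\<forall>i<length l. y i = l ! i)" y, OF that] .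
  have "countable T" unfolding T_def by (intro countable_image) simp
  moreover have "T \<subseteq> S" unfolding T_def using e by blast
  moreover have "S \<subseteq> closure T"
  proof
    fix x assume x: "x \<in> S"
    show "x \<in> closure T"
      unfolding in_closure_iff_cylinder
    proof
      fix j
      have *: "x \<in> S \<and> (\<forall>i<length (map x [0..<j]). x i = map x [0..<j] ! i)"
        using x by simp
      then have "e (map x [0..<j]) \<in> T" unfolding T_def by blast
      moreover have "\<forall>i<j. e (map x [0..<j]) i = x i"
        using e[OF *] by simp
      ultimately show "\<exists>y\<in>T. \<forall>i<j. y i = x i" by blast
    qed
  qed
  ultimately have "countable T \<and> T \<subseteq> S \<and> subtopology euclidean S closure_of T = S"
    by (auto simp: closure_of_subtopology Int_absorb1)
  then show "separable_space (subtopology int_seq_topology S)"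
    unfolding separable_space_def int_seq_topology_eq_euclidean by auto
qed

lemma compact_box: "compact {q :: nat \<Rightarrow> nat \<Rightarrow> int. \<forall>i n. q i n \<in> F i n}"
  if "\<And>i n. finite (F i n)" for F :: "nat \<Rightarrow> nat \<Rightarrow> int set"
proof -
  have "compact (Pi\<^sub>E UNIV (F i))" for i
    using that compactin_PiE[of "\<lambda>_. euclidean :: int topology" UNIV "F i"]
    by (auto simp: euclidean_product_topology finite_imp_compact)
  then have "compact (Pi\<^sub>E UNIV (\<lambda>i. Pi\<^sub>E UNIV (F i)))"
    using compactin_PiE[of "\<lambda>_. euclidean :: (nat \<Rightarrow> int) topology" UNIV "\<lambda>i. Pi\<^sub>E UNIV (F i)"]
    by (auto simp: euclidean_product_topology)
  moreover have "Pi\<^sub>E UNIV (\<lambda>i. Pi\<^sub>E UNIV (F i)) = {q. \<forall>i n. q i n \<in> F i n}"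
    by (auto simp: PiE_iff)
  ultimately show ?thesis by simp
qed

lemma continuous_on_double_coordinate:
  "continuous_on UNIV (\<lambda>q :: nat \<Rightarrow> nat \<Rightarrow> int. q i n)"
  by (rule continuous_on_product_then_coordinatewise[OF continuous_on_product_coordinates])

section \<open>Countably many closed pieces of the generated subgroup\<close>

text \<open>
  Limits of combinations must be taken with fixed coefficients while the sequences vary, possibly
  towards each other; hence ordered tuples in place of finite sets.
\<close>

definition tuple_comb :: "int list \<Rightarrow> (nat \<Rightarrow> nat \<Rightarrow> int) \<Rightarrow> nat \<Rightarrow> int" where
  "tuple_comb a q = (\<lambda>n. \<Sum>i<length a. a ! i * q i n)"

text \<open>
  On an arbitrary closed set large terms may cancel, and the image need not be closed. Finite
  fibres at every coordinate exclude this: tuples whose images converge stay in a compact box, and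
  a cluster point of them is a preimage of the limit.
\<close>

lemma closed_image_finite_fibres:
  fixes D :: "(nat \<Rightarrow> nat \<Rightarrow> int) set"
  assumes "closed D"
    and fin: "\<And>v n. \<exists>F. (\<forall>i. finite (F i)) \<and> (\<forall>q\<in>D. tuple_comb a q n = v \<longrightarrow> (\<forall>i. q i n \<in> F i))"
  shows "closed (tuple_comb a ` D)"
proof -
  have "h \<in> tuple_comb a ` D" if h: "h \<in> closure (tuple_comb a ` D)" for h
  proof -
    have "\<exists>q\<in>D. \<forall>n<j. tuple_comb a q n = h n" for j
      using h by (auto simp: in_closure_iff_cylinder)
    then obtain q where q: "\<And>j. q j \<in> D" "\<And>j n. n < j \<Longrightarrow> tuple_comb a (q j) n = h n"
      by metis
    obtain F where F: "\<And>n i. finite (F n i)"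
        "\<And>n q i. q \<in> D \<Longrightarrow> tuple_comb a q n = h n \<Longrightarrow> q i n \<in> F n i"
    proof -
      have "\<exists>F. \<forall>n. (\<forall>i. finite (F n i)) \<and> (\<forall>q\<in>D. tuple_comb a q n = h n \<longrightarrow> (\<forall>i. q i n \<in> F n i))"
        using fin by (intro choice allI) blast
      then show ?thesis using that by blast
    qed
    \<comment> \<open>Agreement of the image of \<open>q j\<close> with \<open>h\<close> at time \<open>n\<close> is only known for \<open>j > n\<close>.\<close>
    define E where "E i n = F n i \<union> (\<lambda>j. q j i n) ` {..n}" for i n
    have "compact {p. \<forall>i n. p i n \<in> E i n}"
      by (rule compact_box) (auto simp: E_def F(1))
    moreover have "\<forall>j. q j \<in> {p. \<forall>i n. p i n \<in> E i n}"
      using F(2)[OF q(1) q(2)] by (auto simp: E_def not_le[symmetric])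
    ultimately obtain l where l: "inf (nhds l) (filtermap q sequentially) \<noteq> bot"
      by (auto simp: compact_filter eventually_filtermap filtermap_bot_iff
          dest!: spec[of _ "filtermap q sequentially"])
    have cluster: "\<exists>j>n. q j \<in> W" if "open W" "l \<in> W" for W n
    proof (rule ccontr)
      assume "\<not> (\<exists>j>n. q j \<in> W)"
      then have "eventually (\<lambda>p. p \<notin> W) (filtermap q sequentially)"
        unfolding eventually_filtermap by (intro eventually_mono[OF eventually_gt_at_top[of n]]) auto
      moreover have "eventually (\<lambda>p. p \<in> W) (nhds l)"
        using that by (rule eventually_nhds_in_open)
      ultimately have "inf (nhds l) (filtermap q sequentially) = bot"
        unfolding trivial_limit_def eventually_inf by blast
      with l show False by simp
    qed
    have "l \<in> D"
      using cluster[of "- D"] q(1) \<open>closed D\<close> by (auto simp: open_Compl)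
    moreover have "tuple_comb a l n = h n" for n
    proof -
      have "open ((\<lambda>p :: nat \<Rightarrow> nat \<Rightarrow> int. p i n) -` {l i n})" for i
        by (intro open_vimage continuous_on_double_coordinate open_discrete)
      then have "open (\<Inter>i\<in>{..<length a}. (\<lambda>p :: nat \<Rightarrow> nat \<Rightarrow> int. p i n) -` {l i n})"
        by (intro open_INT) auto
      from cluster[OF this, of n] obtain j where "j > n" "\<And>i. i < length a \<Longrightarrow> q j i n = l i n"
        by auto
      then show ?thesis using q(2)[of n j] by (simp add: tuple_comb_def)
    qed
    ultimately show ?thesis by (intro image_eqI[of _ _ l]) auto
  qed
  then show ?thesis by (metis closure_subset_eq subsetI)
qed

text \<open>
  From time \<open>N\<close> on, domination controls all terms. Before time \<open>N\<close> the terms are confined by the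
  constant \<open>B\<close>. The entries beyond \<open>length a\<close> are set to zero to keep compactness in the infinite
  product. All conditions are closed, and countably many triples \<open>(a, N, B)\<close> suffice.
\<close>

definition separated_tuples :: "int list \<Rightarrow> nat \<Rightarrow> nat \<Rightarrow> (nat \<Rightarrow> nat \<Rightarrow> int) set" where
  "separated_tuples a N B = {q. (\<forall>i<length a. a ! i \<noteq> 0) \<and> (\<Sum>i<length a. \<bar>a ! i\<bar>) \<le> int N \<and>
     (\<forall>i<length a. q i \<in> admissible_seqs) \<and> (\<forall>i\<ge>length a. \<forall>n. q i n = 0) \<and>
     (\<forall>i<length a. \<forall>n<N. \<bar>q i n\<bar> \<le> int B) \<and>
     (\<forall>n\<ge>N. inj_on (\<lambda>i. code (q i n)) {..<length a})}"

lemma closed_tuple_member: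
  assumes "closed C"
  shows "closed {q :: nat \<Rightarrow> nat \<Rightarrow> int. q i \<in> C}"
  using closed_vimage[OF assms continuous_on_product_coordinates, of i] by (simp add: vimage_def)

lemma closed_separated_tuples: "closed (separated_tuples a N B)"
proof -
  let ?I = "{..<length a}"
  have "closed {q :: nat \<Rightarrow> nat \<Rightarrow> int. q i n = 0}" for i n
    by (rule closed_continuous_int_relation[of _ _ "\<lambda>u v. u = 0", OF continuous_on_double_coordinate continuous_on_double_coordinate])
  moreover have "closed {q :: nat \<Rightarrow> nat \<Rightarrow> int. \<bar>q i n\<bar> \<le> int B}" for i n
    by (rule closed_continuous_int_relation[of _ _ "\<lambda>u v. \<bar>u\<bar> \<le> int B", OF continuous_on_double_coordinate continuous_on_double_coordinate])
  moreover have "closed {q :: nat \<Rightarrow> nat \<Rightarrow> int. code (q i n) = code (q k n) \<longrightarrow> i = k}" for i k n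
    by (rule closed_continuous_int_relation[of _ _ "\<lambda>u v. code u = code v \<longrightarrow> i = k", OF continuous_on_double_coordinate continuous_on_double_coordinate])
  moreover note closed_tuple_member[OF closed_admissible_seqs]
  moreover have "separated_tuples a N B =
      {q. (\<forall>i<length a. a ! i \<noteq> 0) \<and> (\<Sum>i<length a. \<bar>a ! i\<bar>) \<le> int N} \<inter>
      (\<Inter>i\<in>?I. {q. q i \<in> admissible_seqs}) \<inter> (\<Inter>i\<in>{length a..}. \<Inter>n. {q. q i n = 0}) \<inter>
      (\<Inter>i\<in>?I. \<Inter>n\<in>{..<N}. {q. \<bar>q i n\<bar> \<le> int B}) \<inter>
      (\<Inter>n\<in>{N..}. \<Inter>i\<in>?I. \<Inter>k\<in>?I. {q. code (q i n) = code (q k n) \<longrightarrow> i = k})"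
    unfolding separated_tuples_def inj_on_def by auto
  ultimately show ?thesis
    by (auto simp only: intro!: closed_Int closed_INT closed_Collect_const)
qed

lemma closed_tuple_comb_image:
  assumes "closed D" "D \<subseteq> separated_tuples a N B"
  shows "closed (tuple_comb a ` D)"
proof (rule closed_image_finite_fibres[OF assms(1)])
  fix v n
  define b where "b = int (if n < N then B else centre (nat \<bar>v\<bar>) + nat \<bar>v\<bar>)"
  have "q i n \<in> {-b..b}" if q: "q \<in> D" "tuple_comb a q n = v" for q i
  proof -
    have S: "q \<in> separated_tuples a N B" using q assms by auto
    consider "i \<ge> length a" | "i < length a" "n < N" | "i < length a" "n \<ge> N" by linarith
    then show ?thesis
    proof cases
      case 3
      have adm: "admissible (q i) n" if "i < length a" for i
        using S that by (auto simp: separated_tuples_def admissible_seqs_def)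
      have "int (code (q i n)) < \<bar>\<Sum>i<length a. a ! i * q i n\<bar>"
      proof (rule code_less_abs_sum[where n=N])
        show "near_centre (q i n)" "N \<le> code (q i n)" if "i \<in> {..<length a}" for i
          using adm[of i] that 3 by (auto simp: admissible_def)
      qed (use S 3 in \<open>auto simp: separated_tuples_def\<close>)
      then have "code (q i n) \<le> nat \<bar>v\<bar>" using q(2) by (simp add: tuple_comb_def)
      then have "int (centre (code (q i n)) + code (q i n)) \<le> b"
        using mono_centre 3(2) by (simp only: b_def of_nat_le_iff) simp
      then have "\<bar>q i n\<bar> \<le> b"
        using near_centre_abs_le[of "q i n"] adm[OF 3(1)] by (simp add: admissible_def)
      then show ?thesis by auto
    qed (use S in \<open>auto simp: separated_tuples_def b_def abs_le_iff minus_le_iff\<close>)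
  qed
  then show "\<exists>F. (\<forall>i. finite (F i)) \<and> (\<forall>q\<in>D. tuple_comb a q n = v \<longrightarrow> (\<forall>i. q i n \<in> F i))"
    by (intro exI[of _ "\<lambda>_. {-b..b}"]) auto
qed

lemma separated_tuple_inj:
  assumes "q \<in> separated_tuples a N B"
  shows "inj_on q {..<length a}"
  using assms by (auto simp: separated_tuples_def inj_on_def) 

lemma tuple_comb_eq_lin_comb:
  assumes "inj_on q {..<length a}"
  shows "tuple_comb a q = lin_comb (\<lambda>p. a ! the_inv_into {..<length a} q p) (q ` {..<length a})"
  using assms by (auto simp: tuple_comb_def lin_comb_def sum.reindex the_inv_into_f_f)

text \<open>
  Otherwise the difference of two combinations vanishes identically, yet the stalled sequence
  occurs with non-zero coefficient on one side only. Its codes eventually differ from those of the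
  generators on the other side because these do not stall, and from those of its own tuple because
  the tuple is separated; so domination applies to the difference.
\<close>

lemma stalled_tuple_comb_notin_lin_combs:
  assumes q: "q \<in> separated_tuples a N B" and i: "i < length a" "q i \<in> stalled K"
  shows "tuple_comb a q \<notin> lin_combs"
proof
  assume "tuple_comb a q \<in> lin_combs"
  then obtain b R where R: "finite R" "R \<subseteq> generators" "tuple_comb a q = lin_comb b R"
    by (auto simp: lin_combs_def)
  define Q where "Q = q ` {..<length a}"
  define c where "c p = a ! the_inv_into {..<length a} q p" for p
  have inj: "inj_on q {..<length a}" by (rule separated_tuple_inj[OF q])
  have z: "tuple_comb a q = lin_comb c Q"
    unfolding c_def Q_def by (rule tuple_comb_eq_lin_comb[OF inj])
  define d where "d p = (if p \<in> Q then c p else 0) - (if p \<in> R then b p else 0)" for p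
  have "finite Q" "Q \<subseteq> admissible_seqs" using q by (auto simp: Q_def separated_tuples_def)
  have "lin_comb d (Q \<union> R) n = 0" for n
    unfolding d_def lin_comb_diff
    using lin_comb_support[of Q "Q \<union> R" c] lin_comb_support[of R "Q \<union> R" b] z R \<open>finite Q\<close>
    by (simp add: fun_eq_iff)
  moreover have "finite {n. lin_comb d (Q \<union> R) n = 0}"
  proof (rule finite_zeros_lin_comb)
    show "finite (Q \<union> R)" "Q \<union> R \<subseteq> admissible_seqs"
      using \<open>finite Q\<close> \<open>Q \<subseteq> admissible_seqs\<close> R generators_admissible by auto
    show "q i \<in> Q \<union> R" using i by (auto simp: Q_def)
    have "q i \<notin> R" using i R by (auto simp: generators_def)
    then show "d (q i) \<noteq> 0"
      using i q the_inv_into_f_f[OF inj, of i] by (auto simp: d_def Q_def c_def separated_tuples_def)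
    fix p r assume pr: "p \<in> Q \<union> R" "r \<in> Q \<union> R" "p \<noteq> r"
    then consider "p \<in> Q" "r \<in> Q" | "p \<in> R" | "r \<in> R" by auto
    then show "\<exists>M. \<forall>n\<ge>M. code (p n) \<noteq> code (r n)"
    proof cases
      case 1
      then obtain j k where "p = q j" "r = q k" "j < length a" "k < length a"
        by (auto simp: Q_def)
      then have "\<forall>n\<ge>N. code (p n) \<noteq> code (r n)"
        using pr(3) q unfolding separated_tuples_def inj_on_def by blast
      then show ?thesis by blast
    next
      case 2
      then show ?thesis
        using codes_eventually_differ[of p r] pr R \<open>Q \<union> R \<subseteq> admissible_seqs\<close> by auto
    next
      case 3
      then show ?thesis
        using codes_eventually_differ[of r p] pr R \<open>Q \<union> R \<subseteq> admissible_seqs\<close> by (metis subsetD)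
    qed
  qed
  ultimately show False by simp
qed

text \<open>
  A combination without stalled members has only generators as terms and lies in the subgroup.
  Conversely, a point may have several representing tuples; the previous lemma keeps all of them
  free of stalled sequences when the point lies in the subgroup.
\<close>

lemma lin_combs_Int_tuple_combs:
  "lin_combs \<inter> tuple_comb a ` separated_tuples a N B =
   tuple_comb a ` separated_tuples a N B -
     (\<Union>K. \<Union>i<length a. tuple_comb a ` (separated_tuples a N B \<inter> {q. q i \<in> stalled K}))"
  (is "lin_combs \<inter> ?Z = ?Z - ?W")
proof
  show "lin_combs \<inter> ?Z \<subseteq> ?Z - ?W"
    using stalled_tuple_comb_notin_lin_combs by auto
  show "?Z - ?W \<subseteq> lin_combs \<inter> ?Z"
  proof
    fix z assume z: "z \<in> ?Z - ?W"
    then obtain q where q: "q \<in> separated_tuples a N B" "z = tuple_comb a q" by auto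
    have "q i \<in> generators" if "i < length a" for i
      using z q that by (auto simp: generators_def separated_tuples_def)
    then have "z \<in> lin_combs"
      unfolding q(2) tuple_comb_eq_lin_comb[OF separated_tuple_inj[OF q(1)]] lin_combs_def by blast
    with z show "z \<in> lin_combs \<inter> ?Z" by simp
  qed
qed

lemma gdelta_lin_combs_Int: "gdelta_in int_seq_topology (lin_combs \<inter> tuple_comb a ` separated_tuples a N B)"
  unfolding lin_combs_Int_tuple_combs
  by (intro gdelta_closed_diff closed_UN finite_lessThan ballI closed_tuple_comb_image[of _ a N B]
      closed_Int closed_separated_tuples closed_tuple_member closed_stalled) auto

lemma lin_combs_covered:
  assumes "z \<in> lin_combs"
  shows "\<exists>a N B. z \<in> tuple_comb a ` separated_tuples a N B"
proof -
  obtain b R where R: "finite R" "R \<subseteq> generators" "z = lin_comb b R"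
    using assms by (auto simp: lin_combs_def)
  define Q where "Q = {p \<in> R. b p \<noteq> 0}"
  have Q: "finite Q" "Q \<subseteq> generators" using R by (auto simp: Q_def)
  have z: "z n = (\<Sum>p\<in>Q. b p * p n)" for n
    unfolding R(3) lin_comb_def Q_def using R(1) by (intro sum.mono_neutral_right) auto
  obtain l where l: "set l = Q" "distinct l" using finite_distinct_list[OF Q(1)] by blast
  define a where "a = map b l"
  define q where "q i n = (if i < length l then (l ! i) n else 0)" for i n
  have q: "q i = l ! i" if "i < length l" for i using that by (auto simp: q_def)
  have gen: "l ! i \<in> generators" "l ! i \<in> admissible_seqs" if "i < length l" for i
    using that l Q generators_admissible nth_mem by blast+
  have "\<exists>M. \<forall>n\<ge>M. code ((l ! i) n) \<noteq> code ((l ! k) n)"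
    if "i < length l" "k < length l" "i \<noteq> k" for i k
    using that gen l by (intro codes_eventually_differ) (auto simp: nth_eq_iff_index_eq)
  then obtain M where M: "\<And>i k n. i < length l \<Longrightarrow> k < length l \<Longrightarrow> i \<noteq> k \<Longrightarrow> n \<ge> M i k \<Longrightarrow>
      code ((l ! i) n) \<noteq> code ((l ! k) n)"
    by metis
  define L where "L = Max (insert 0 ((\<lambda>(i, k). M i k) ` ({..<length l} \<times> {..<length l})))"
  define N where "N = max L (nat (\<Sum>i<length a. \<bar>a ! i\<bar>))"
  have N: "M i k \<le> N" if "i < length l" "k < length l" for i k
  proof -
    have "M i k \<le> L" unfolding L_def using that by (intro Max_ge) auto
    then show ?thesis by (simp add: N_def)
  qed
  define B where "B = Max (insert 0 ((\<lambda>(i, n). nat \<bar>q i n\<bar>) ` ({..<length l} \<times> {..<N})))"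
  have "nat \<bar>q i n\<bar> \<le> B" if "i < length l" "n < N" for i n
    unfolding B_def using that by (intro Max_ge) auto
  then have B: "\<bar>q i n\<bar> \<le> int B" if "i < length l" "n < N" for i n
    using that by (simp add: nat_le_iff)
  have "q \<in> separated_tuples a N B"
    unfolding separated_tuples_def
  proof (intro CollectI conjI allI impI inj_onI)
    show "a ! i \<noteq> 0" if "i < length a" for i
      using that l nth_mem[of i l] by (auto simp: a_def Q_def)
    show "(\<Sum>i<length a. \<bar>a ! i\<bar>) \<le> int N" by (simp add: N_def)
    show "q i n = 0" if "length a \<le> i" for i n using that by (simp add: a_def q_def)
    fix n i k assume "N \<le> n" "i \<in> {..<length a}" "k \<in> {..<length a}" "code (q i n) = code (q k n)"
    then show "i = k" using M[of i k n] N[of i k] q by (force simp: a_def)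
  qed (use q gen B in \<open>auto simp: a_def\<close>)
  moreover have "z = tuple_comb a q"
  proof
    fix n
    have "z n = (\<Sum>i<length l. b (l ! i) * (l ! i) n)"
      unfolding z l(1)[symmetric] using l(2) by (simp add: sum.distinct_set_conv_list sum_list_sum_nth atLeast0LessThan)
    also have "\<dots> = tuple_comb a q n"
      unfolding tuple_comb_def by (intro sum.cong) (auto simp: a_def q)
    finally show "z n = tuple_comb a q n" .
  qed
  ultimately show ?thesis by blast
qed

lemma sigma_Polish_lin_combs: "sigma_Polish_space (subtopology int_seq_topology lin_combs)"
proof -
  define Z where "Z m = (case from_nat m of (a, N, B) \<Rightarrow> tuple_comb a ` separated_tuples a N B)" for m
  have Z: "\<exists>a N B. Z m = tuple_comb a ` separated_tuples a N B" for m
    unfolding Z_def by (auto split: prod.split)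
  have "closed (Z m)" for m
    using Z[of m] closed_tuple_comb_image[OF closed_separated_tuples order_refl] by auto
  then have "closedin (subtopology int_seq_topology lin_combs) (lin_combs \<inter> Z m)" for m
    unfolding int_seq_topology_eq_euclidean by (intro closedin_closed_Int)
  moreover have "Polish_space (subtopology int_seq_topology (lin_combs \<inter> Z m))" for m
    using Z[of m] gdelta_imp_Polish[OF gdelta_lin_combs_Int] by auto
  moreover have "lin_combs \<subseteq> (\<Union>m. Z m)"
  proof
    fix z assume "z \<in> lin_combs"
    then obtain a N B where "z \<in> tuple_comb a ` separated_tuples a N B" using lin_combs_covered by blast
    then have "z \<in> Z (to_nat (a, N, B))" by (simp add: Z_def)
    then show "z \<in> (\<Union>m. Z m)" by blast
  qed
  ultimately show ?thesis
    unfolding sigma_Polish_space_def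
    by (intro exI[of _ "\<lambda>m. lin_combs \<inter> Z m"]) (auto simp: subtopology_subtopology)
qed

section \<open>Large closures of relatively open sets\<close>

text \<open>
  Announcing the complete past from time \<open>j\<close> on prevents stalling after any prefix; hence the
  generators are dense among the admissible sequences.
\<close>

function commit :: "(nat \<Rightarrow> int) \<Rightarrow> nat \<Rightarrow> nat \<Rightarrow> int" where
  "commit y j n = (if n < j then y n
     else int (centre (prod_encode (to_nat (map (commit y j) [0..<n]), n))))"
  by auto
termination
  by (relation "Wellfounded.measure (\<lambda>(y, j, n). n)") auto

declare commit.simps [simp del]

lemma commit_below: "n < j \<Longrightarrow> commit y j n = y n"
  by (simp add: commit.simps)

lemma code_near_encode:
  assumes "\<bar>u - int (centre (prod_encode (to_nat l, m)))\<bar> \<le> int m"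
  shows "near_centre u" "m \<le> code u" "label u = l"
proof -
  have "m \<le> prod_encode (to_nat l, m)" by (rule le_prod_encode_2)
  then have *: "\<bar>u - int (centre (prod_encode (to_nat l, m)))\<bar> \<le> int (prod_encode (to_nat l, m))"
    using assms by linarith
  show "near_centre u" "m \<le> code u" "label u = l"
    using near_centreI[OF *] code_eqI[OF *] by (simp_all add: le_prod_encode_2 label_def)
qed

lemma commit_in_generators:
  assumes "\<And>n. n < j \<Longrightarrow> admissible y n"
  shows "commit y j \<in> generators"
proof -
  have high: "near_centre (commit y j n) \<and> n \<le> code (commit y j n) \<and>
      label (commit y j n) = map (commit y j) [0..<n]" if "n \<ge> j" for n
    using code_near_encode[of "commit y j n" "map (commit y j) [0..<n]" n] that
    by (auto simp: commit.simps[of y j n])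
  have low: "admissible (commit y j) n" if "n < j" for n
    using assms[OF that] admissible_cong[of n "commit y j" y] that by (simp add: commit_below)
  have len: "length (label (commit y j n)) \<le> n" for n
    using low[of n] high[of n] by (cases "n < j") (auto simp: admissible_def)
  have "admissible (commit y j) n" for n
  proof (cases "n < j")
    case False
    moreover have "length (label (commit y j m)) \<le> n" if "m \<le> n" for m
      using len[of m] that by simp
    ultimately show ?thesis using high[of n] by (simp add: admissible_def)
  qed (rule low)
  moreover have "commit y j \<notin> stalled K" for K
  proof -
    have "length (label (commit y j (max j (Suc K)))) = max j (Suc K)"
      using high[of "max j (Suc K)"] by simp
    then show ?thesis by (auto simp: stalled_def not_le intro!: exI[of _ "max j (Suc K)"])
  qed
  ultimately show ?thesis unfolding generators_def admissible_seqs_def by blast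
qed

lemma generators_nonempty: "generators \<noteq> {}"
  using commit_in_generators[of 0] by auto

lemma admissible_in_closure:
  assumes "y \<in> admissible_seqs" and agree: "\<forall>i<j. y i = u i"
    and U: "{p \<in> generators. \<forall>i<j. p i = u i} \<subseteq> U"
  shows "y \<in> closure U"
  unfolding in_closure_iff_cylinder
proof
  fix k
  let ?p = "commit y (max j k)"
  have "?p \<in> generators" using assms(1) by (intro commit_in_generators) (simp add: admissible_seqs_def)
  moreover have "\<forall>i<j. ?p i = u i" "\<forall>i<k. ?p i = y i"
    using agree by (auto simp: commit_below)
  ultimately show "\<exists>p\<in>U. \<forall>i<k. p i = y i" using U by blast
qed

lemma compact_coordinate_bound:
  assumes "compactin int_seq_topology K"
  shows "\<exists>b :: nat \<Rightarrow> nat. \<forall>x\<in>K. \<forall>n. \<bar>x n\<bar> \<le> int (b n)"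
proof -
  have "finite ((\<lambda>x. x n) ` K)" for n
  proof -
    have "continuous_map int_seq_topology (discrete_topology UNIV) (\<lambda>x. x n)"
      unfolding int_seq_topology_def by (rule continuous_map_product_projection) simp
    then have "compactin (discrete_topology UNIV) ((\<lambda>x. x n) ` K)"
      using assms image_compactin by blast
    then show ?thesis by (simp add: compactin_discrete_topology)
  qed
  then have "\<exists>b. \<forall>v\<in>(\<lambda>x. x n) ` K. nat \<bar>v\<bar> \<le> b" for n
    by (intro exI[of _ "Max ((\<lambda>v. nat \<bar>v\<bar>) ` (\<lambda>x. x n) ` K)"]) auto
  then obtain b where "\<And>n x. x \<in> K \<Longrightarrow> nat \<bar>x n\<bar> \<le> b n" by (metis imageI)
  then show ?thesis by (intro exI[of _ b]) (auto simp: nat_le_iff)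
qed

text \<open>
  After a prefix \<open>u\<close> of length \<open>j\<close> an admissible sequence may announce this prefix forever, with
  intervals of radius at least \<open>b n\<close>. Such sequences stall, but they are limits of generators with
  the same prefix, and up to a fixed translation \<open>z\<close> they trace any point of a compact set with
  coordinate bounds \<open>b\<close>. The first \<open>j\<close> coordinates are corrected by finitely many translations.
\<close>

lemma prethick_closure:
  assumes "openin (subtopology int_seq_topology generators) U" "U \<noteq> {}"
  shows "prethick int_seq_group int_seq_topology (int_seq_topology closure_of U)"
  unfolding prethick_def
proof (intro conjI allI impI)
  fix K assume "compactin int_seq_topology K"
  then obtain b :: "nat \<Rightarrow> nat" where b: "\<And>x n. x \<in> K \<Longrightarrow> \<bar>x n\<bar> \<le> int (b n)"
    using compact_coordinate_bound by blast
  obtain W where W: "open W" "U = W \<inter> generators"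
    using assms(1) by (auto simp: openin_subtopology int_seq_topology_eq_euclidean)
  obtain u where u: "u \<in> W" "u \<in> generators" using assms(2) W by auto
  obtain j where j: "\<And>y. \<forall>i<j. y i = u i \<Longrightarrow> y \<in> W"
    using open_contains_cylinder[OF W(1) u(1)] by blast
  have adm: "admissible u n" for n using u by (simp add: generators_def admissible_seqs_def)
  define L where "L = map u [0..<j]"
  define z where "z n = int (centre (prod_encode (to_nat L, max n (b n))))" for n
  define t where "t x n = (if n < j then u n else z n + x n)" for x n
  define F where "F = insert (\<lambda>n. 0) ((\<lambda>x n. x n - t x n) ` K)"
  have t_closure: "t x \<in> closure U" if "x \<in> K" for x
  proof (rule admissible_in_closure)
    show "\<forall>i<j. t x i = u i" by (simp add: t_def)
    show "{p \<in> generators. \<forall>i<j. p i = u i} \<subseteq> U" using j W(2) by auto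
    have high: "near_centre (t x n) \<and> n \<le> code (t x n) \<and> label (t x n) = L" if "n \<ge> j" for n
      using code_near_encode[of "t x n" L "max n (b n)"] b[OF \<open>x \<in> K\<close>, of n] that
      by (auto simp: t_def z_def)
    have low: "admissible (t x) n" if "n < j" for n
      using adm[of n] admissible_cong[of n "t x" u] that by (simp add: t_def)
    have len: "length (label (t x n)) \<le> j" for n
      using low[of n] high[of n] by (cases "n < j") (auto simp: admissible_def L_def)
    have "admissible (t x) n" for n
    proof (cases "n < j")
      case False
      moreover have "L ! d = t x d" if "d < length L" for d
        using that by (simp add: L_def t_def)
      ultimately show ?thesis using high[of n] len by (simp add: admissible_def L_def)
    qed (rule low)
    then show "t x \<in> admissible_seqs" unfolding admissible_seqs_def by blast
  qed
  have "finite F"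
  proof -
    have "(\<lambda>x n. x n - t x n) ` K \<subseteq>
        (\<lambda>g n. if n < j then g n - u n else - z n) ` (\<Pi>\<^sub>E n\<in>{..<j}. {- int (b n)..int (b n)})"
    proof (rule image_subsetI)
      fix x assume "x \<in> K"
      then have "restrict x {..<j} \<in> (\<Pi>\<^sub>E n\<in>{..<j}. {- int (b n)..int (b n)})"
        using b[of x] by (auto simp: abs_le_iff minus_le_iff)
      moreover have "(\<lambda>n. x n - t x n) = (\<lambda>n. if n < j then restrict x {..<j} n - u n else - z n)"
        by (auto simp: t_def)
      ultimately show "(\<lambda>n. x n - t x n) \<in>
          (\<lambda>g n. if n < j then g n - u n else - z n) ` (\<Pi>\<^sub>E n\<in>{..<j}. {- int (b n)..int (b n)})"
        by blast
    qed
    moreover have "finite (\<Pi>\<^sub>E n\<in>{..<j}. {- int (b n)..int (b n)})" by (rule finite_PiE) auto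
    ultimately show ?thesis unfolding F_def by (meson finite_imageI finite_insert finite_subset)
  qed
  moreover have "K \<subseteq> {a \<otimes>\<^bsub>int_seq_group\<^esub> s \<otimes>\<^bsub>int_seq_group\<^esub> c | a s c.
      a \<in> F \<and> s \<in> int_seq_topology closure_of U \<and> c \<in> F}"
  proof
    fix x assume x: "x \<in> K"
    have "x = (\<lambda>n. x n - t x n) \<otimes>\<^bsub>int_seq_group\<^esub> t x \<otimes>\<^bsub>int_seq_group\<^esub> (\<lambda>n. 0)" by simp
    moreover have "(\<lambda>n. x n - t x n) \<in> F" "(\<lambda>n. 0) \<in> F" using x by (auto simp: F_def)
    moreover have "t x \<in> int_seq_topology closure_of U"
      using t_closure[OF x] by (simp add: int_seq_topology_eq_euclidean)
    ultimately show "x \<in> {a \<otimes>\<^bsub>int_seq_group\<^esub> s \<otimes>\<^bsub>int_seq_group\<^esub> c | a s c.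
      a \<in> F \<and> s \<in> int_seq_topology closure_of U \<and> c \<in> F}" by blast
  qed
  ultimately show "\<exists>F. finite F \<and> F \<subseteq> carrier int_seq_group \<and>
      K \<subseteq> {a \<otimes>\<^bsub>int_seq_group\<^esub> s \<otimes>\<^bsub>int_seq_group\<^esub> c | a s c.
        a \<in> F \<and> s \<in> int_seq_topology closure_of U \<and> c \<in> F}"
    by (intro exI[of _ F]) auto
qed simp

section \<open>Category arguments\<close>

lemma interior_of_countable_Union_nowhere_dense:
  assumes "completely_metrizable_space X" "countable \<N>" "\<And>N. N \<in> \<N> \<Longrightarrow> nowhere_dense_in X N"
  shows "X interior_of (\<Union>\<N>) = {}"
proof -
  have "X interior_of (\<Union>N\<in>\<N>. X closure_of N) = {}"
    using assms by (intro Baire_category_alt) (auto simp: nowhere_dense_in_def)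
  moreover have "X interior_of (\<Union>\<N>) \<subseteq> X interior_of (\<Union>N\<in>\<N>. X closure_of N)"
    using assms(3) by (intro interior_of_mono UN_mono[of \<N> \<N> "\<lambda>N. N", simplified] Sup_least)
      (auto simp: nowhere_dense_in_def dest: closure_of_subset)
  ultimately show ?thesis by simp
qed

text \<open>
  Finitely many translates of the set cover the image of the compact witness, so the witness is a
  finite union of meager sets, against Baire's theorem.
\<close>

lemma prethick_not_Haar_meager:
  assumes "prethick G X T" "Haar_meager G X A" "group G" "T \<subseteq> A"
  shows False
proof -
  interpret group G by fact
  obtain K :: "(nat \<Rightarrow> real) topology" and f where K: "topspace K \<noteq> {}" "compact_space K"
      "metrizable_space K" "continuous_map K X f"
    and meager: "\<And>x y. x \<in> carrier G \<Longrightarrow> y \<in> carrier G \<Longrightarrow>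
        meager_in K {k \<in> topspace K. f k \<in> (\<lambda>a. x \<otimes>\<^bsub>G\<^esub> a \<otimes>\<^bsub>G\<^esub> y) ` A}"
    using assms(2) by (auto simp: Haar_meager_def)
  have "compactin X (f ` topspace K)"
    using K image_compactin by (auto simp: compact_space_def)
  then obtain F where F: "finite F" "F \<subseteq> carrier G"
      "f ` topspace K \<subseteq> {a \<otimes>\<^bsub>G\<^esub> t \<otimes>\<^bsub>G\<^esub> b | a t b. a \<in> F \<and> t \<in> T \<and> b \<in> F}"
    using assms(1) unfolding prethick_def by blast
  define M where "M a b = {k \<in> topspace K. f k \<in> (\<lambda>t. a \<otimes>\<^bsub>G\<^esub> t \<otimes>\<^bsub>G\<^esub> b) ` A}" for a b
  have "meager_in K (M a b)" if "a \<in> F" "b \<in> F" for a b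
    using meager[of a b] that F(2) by (auto simp: M_def)
  then have "\<exists>N :: nat \<Rightarrow> _. (\<forall>n. nowhere_dense_in K (N n)) \<and> M a b = (\<Union>n. N n)"
    if "a \<in> F" "b \<in> F" for a b
    using that by (simp add: meager_in_def)
  then obtain N :: "_ \<Rightarrow> _ \<Rightarrow> nat \<Rightarrow> _" where N:
      "\<And>a b n. a \<in> F \<Longrightarrow> b \<in> F \<Longrightarrow> nowhere_dense_in K (N a b n)"
      "\<And>a b. a \<in> F \<Longrightarrow> b \<in> F \<Longrightarrow> M a b = (\<Union>n. N a b n)"
    by metis
  define \<N> where "\<N> = (\<Union>a\<in>F. \<Union>b\<in>F. range (N a b))"
  have "locally_compact_space K" "regular_space K"
    using K by (auto simp: compact_imp_locally_compact_space metrizable_imp_regular_space)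
  have "topspace K \<subseteq> \<Union>\<N>"
  proof
    fix k assume k: "k \<in> topspace K"
    then obtain a t b where "a \<in> F" "t \<in> T" "b \<in> F" "f k = a \<otimes>\<^bsub>G\<^esub> t \<otimes>\<^bsub>G\<^esub> b" using F(3) by blast
    then have "k \<in> M a b" using k assms(4) by (auto simp: M_def)
    then show "k \<in> \<Union>\<N>" using N(2) \<open>a \<in> F\<close> \<open>b \<in> F\<close> by (auto simp: \<N>_def)
  qed
  moreover have "\<Union>\<N> \<subseteq> topspace K"
    using N(1) by (auto simp: \<N>_def nowhere_dense_in_def)
  moreover have "K interior_of (\<Union>\<N>) = {}"
  proof (rule interior_of_countable_Union_nowhere_dense)
    show "completely_metrizable_space K"
      using K locally_compact_imp_completely_metrizable_space \<open>locally_compact_space K\<close> by blast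
    show "countable \<N>" unfolding \<N>_def using F(1) by (intro countable_UN) (auto intro: countable_finite)
    show "nowhere_dense_in K S" if "S \<in> \<N>" for S using that N(1) by (auto simp: \<N>_def)
  qed
  ultimately have "K interior_of (topspace K) = {}" by (simp add: subset_antisym)
  then show False using K(1) by simp
qed

text \<open>
  By Baire's theorem in the Polish space of generators, one of the closed sets contains a non-empty
  relatively open set of generators, and with it the prethick closure of that set.
\<close>

lemma generators_not_covered:
  assumes "countable \<A>" 
    and "\<And>A. A \<in> \<A> \<Longrightarrow> closedin int_seq_topology A \<and> Haar_meager int_seq_group int_seq_topology A"
  shows "\<not> generators \<subseteq> \<Union>\<A>"
proof
  assume cover: "generators \<subseteq> \<Union>\<A>"
  let ?P = "subtopology int_seq_topology generators"
  have empty: "?P interior_of (generators \<inter> A) = {}" if A: "A \<in> \<A>" for A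
  proof (rule ccontr)
    let ?U = "?P interior_of (generators \<inter> A)"
    assume "?U \<noteq> {}"
    then have "prethick int_seq_group int_seq_topology (int_seq_topology closure_of ?U)"
      by (intro prethick_closure) auto
    moreover have "int_seq_topology closure_of ?U \<subseteq> A"
      using assms(2)[OF A] interior_of_subset[of ?P "generators \<inter> A"]
      by (intro closure_of_minimal) auto
    ultimately show False
      using prethick_not_Haar_meager assms(2)[OF A] group_int_seq_group by blast
  qed
  have "?P interior_of \<Union>((\<inter>) generators ` \<A>) = {}"
  proof (rule Baire_category_alt)
    show "completely_metrizable_space ?P \<or> locally_compact_space ?P \<and> regular_space ?P"
      using gdelta_imp_Polish[OF gdelta_generators] by (simp add: Polish_space_def)
    show "countable ((\<inter>) generators ` \<A>)" using assms(1) by simp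
    show "closedin ?P S \<and> ?P interior_of S = {}" if "S \<in> (\<inter>) generators ` \<A>" for S
      using that assms(2) empty by (auto simp: closedin_subtopology_Int_closed)
  qed
  moreover have "\<Union>((\<inter>) generators ` \<A>) = topspace ?P" using cover by auto
  ultimately have "?P interior_of topspace ?P = {}" by metis
  then show False using generators_nonempty by (simp only: interior_of_topspace) simp
qed

text \<open>
  The zero sequence and the sequences without zeros from \<open>m\<close> on form a closed set \<open>W m\<close>, and any
  prefix has a continuation outside of it.
\<close>

lemma meager_lin_combs: "meager_in int_seq_topology lin_combs"
proof -
  define W :: "nat \<Rightarrow> (nat \<Rightarrow> int) set" where "W m = (\<Inter>n. {z. z n = 0}) \<union> (\<Inter>n\<in>{m..}. {z. z n \<noteq> 0})" for m
  have "closed (W m)" for m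
    unfolding W_def using closed_coordinates[of "\<lambda>u v. u = 0"] closed_coordinates[of "\<lambda>u v. u \<noteq> 0"]
    by (intro closed_Un closed_INT ballI)
  have "interior (W m) = {}" for m
  proof (rule ccontr)
    assume "interior (W m) \<noteq> {}"
    then obtain x where "x \<in> interior (W m)" by blast
    then obtain j where j: "\<And>y. \<forall>i<j. y i = x i \<Longrightarrow> y \<in> interior (W m)"
      using open_contains_cylinder[OF open_interior] by blast
    \<comment> \<open>The final ones keep \<open>y\<close> different from the zero sequence, which belongs to \<open>W m\<close>.\<close>
    define y where "y i = (if i < j then x i else if i = max j m then 0 else 1)" for i
    have "y \<in> W m" using j[of y] interior_subset by (auto simp: y_def)
    moreover have "y (max j m) = 0" "y (Suc (max j m)) \<noteq> 0" by (auto simp: y_def)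
    ultimately show False by (auto simp: W_def)
  qed
  then have "interior (closure (lin_combs \<inter> W m)) = {}" for m
    using \<open>closed (W m)\<close> closure_minimal[of "lin_combs \<inter> W m" "W m"] interior_mono by blast
  moreover have "lin_combs = (\<Union>m. lin_combs \<inter> W m)"
  proof -
    have "\<exists>m. z \<in> W m" if z: "z \<in> lin_combs" for z
    proof (cases "z = (\<lambda>n. 0)")
      case False
      then have "finite {n. z n = 0}" using finite_zeros_lin_combs[OF z] by blast
      then obtain m where "\<forall>n\<in>{n. z n = 0}. n < m" using finite_nat_set_iff_bounded by blast
      then have "z \<in> W m" by (force simp: W_def)
      then show ?thesis ..
    qed (simp add: W_def)
    then show ?thesis by blast
  qed
  ultimately show ?thesis
    unfolding meager_in_def nowhere_dense_in_def int_seq_topology_eq_euclidean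
    by (intro exI[of _ "\<lambda>m. lin_combs \<inter> W m"]) simp
qed

theorem mainTheorem3:
  shows "\<exists>H. subgroup H int_seq_group \<and>
    \<comment> \<open>(i)\<close>
    meager_in int_seq_topology H \<and>
    sigma_Polish_space (subtopology int_seq_topology H) \<and>
    \<comment> \<open>(ii)\<close>
    H \<subseteq> {\<one>\<^bsub>int_seq_group\<^esub>} \<union> {z. finite {n. z n = 0}} \<and>
    \<comment> \<open>(iii)\<close>
    (\<nexists>\<A>. countable \<A> \<and>
         (\<forall>A \<in> \<A>. closedin int_seq_topology A \<and> Haar_meager int_seq_group int_seq_topology A) \<and>
         H \<subseteq> \<Union>\<A>) \<and>
    \<comment> \<open>(iv)\<close>
    (\<exists>P. gdelta_in int_seq_topology P \<and>
         H = generate int_seq_group P \<and>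
         (\<forall>U. openin (subtopology int_seq_topology P) U \<and> U \<noteq> {} \<longrightarrow>
              prethick int_seq_group int_seq_topology (int_seq_topology closure_of U)))"
proof (rule exI[of _ lin_combs], intro conjI)
  show "lin_combs \<subseteq> {\<one>\<^bsub>int_seq_group\<^esub>} \<union> {z. finite {n. z n = 0}}"
    using finite_zeros_lin_combs by auto
  have "generators \<subseteq> lin_combs" unfolding lin_combs_eq_generate by (auto intro: generate.incl)
  then show "\<nexists>\<A>. countable \<A> \<and>
         (\<forall>A \<in> \<A>. closedin int_seq_topology A \<and> Haar_meager int_seq_group int_seq_topology A) \<and>
         lin_combs \<subseteq> \<Union>\<A>"
    using generators_not_covered by (meson subset_trans)
  show "\<exists>P. gdelta_in int_seq_topology P \<and> lin_combs = generate int_seq_group P \<and>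
         (\<forall>U. openin (subtopology int_seq_topology P) U \<and> U \<noteq> {} \<longrightarrow>
              prethick int_seq_group int_seq_topology (int_seq_topology closure_of U))"
    using gdelta_generators lin_combs_eq_generate prethick_closure by blast
qed (rule subgroup_lin_combs meager_lin_combs sigma_Polish_lin_combs)+

end
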